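(* Let $V$ and $V'$ be left vector spaces over division rings $R$ and $R'$, respectively, both of dimension at least $3$ (possibly infinite-dimensional). If $f:\mathcal{P}(V)\to\mathcal{P}(V')$ is a PGL-bijection (that is, a PGL-mapping which is bijective), then $f^{-1}:\mathcal{P}(V')\to\mathcal{P}(V)$ is a semicollineation.
   Context: For a left vector space $V$ over a division ring, $\mathcal{P}(V)$ is the associated projective space: its points are the $1$-dimensional subspaces of $V$, and its lines are the sets of all $1$-dimensional subspaces contained in a given $2$-dimensional subspace of $V$. $\mathrm{PGL}(V)$ is identified with the group of all transformations of $\mathcal{P}(V)$ induced by linear automorphisms of $V$, i.e. the maps $P\mapsto u(P)$ with $u\in \mathrm{GL}(V)$. A mapping $f:\mathcal{P}(V)\to\mathcal{P}(V')$ is a PGL-mapping if for every $h\in\mathrm{PGL}(V)$ there exists $h'\in\mathrm{PGL}(V')$ such that $fh=h'f$ (for bijective $f$: $fhf^{-1}\in\mathrm{PGL}(V')$ for every $h\in\mathrm{PGL}(V)$). Three distinct points of a projective space are collinear if some line contains all of them. A bijection between two projective spaces is a semicollineation if it sends every triple of (distinct) collinear points to a triple of collinear points. *)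

theory Defs
  imports "HOL.Vector_Spaces" "HOL-Library.FuncSet"
begin

text \<open>
  \<^locale>\<open>vector_space\<close> and \<^locale>\<open>module\<close> require commutative scalars. The basic notions are
  therefore restated here for a left vector space over an arbitrary division ring, with the
  definitions of \<^theory>\<open>HOL.Modules\<close>. As there, the carrier is the whole type.
\<close>

locale left_vector_space =
  fixes scale :: "'a::division_ring \<Rightarrow> 'b::ab_group_add \<Rightarrow> 'b"  (infixr \<open>*s\<close> 75)
  assumes scale_right_distrib: "a *s (x + y) = a *s x + a *s y"
    and scale_left_distrib: "(a + b) *s x = a *s x + b *s x"
    and scale_scale: "a *s (b *s x) = (a * b) *s x"
    and scale_one: "1 *s x = x"
begin

definition span :: "'b set \<Rightarrow> 'b set"
  where "span B = {(\<Sum>v\<in>t. c v *s v) | t c. finite t \<and> t \<subseteq> B}"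

definition independent :: "'b set \<Rightarrow> bool"
  where "independent B \<longleftrightarrow>
    (\<forall>t c. finite t \<and> t \<subseteq> B \<and> (\<Sum>v\<in>t. c v *s v) = 0 \<longrightarrow> (\<forall>v\<in>t. c v = 0))"

definition basis_of :: "'b set \<Rightarrow> 'b set \<Rightarrow> bool"
  where "basis_of W B \<longleftrightarrow> independent B \<and> span B = W"

text \<open>Since \<^term>\<open>span B\<close> is a subspace, \<^term>\<open>W\<close> need not be required to be one.\<close>

definition subspace_of_dim :: "nat \<Rightarrow> 'b set \<Rightarrow> bool"
  where "subspace_of_dim n W \<longleftrightarrow> (\<exists>B. basis_of W B \<and> finite B \<and> card B = n)"

text \<open>The whole space has dimension at least \<^term>\<open>n\<close>, possibly infinite.\<close>

definition dim_at_least :: "nat \<Rightarrow> bool"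
  where "dim_at_least n \<longleftrightarrow> (\<exists>B. basis_of UNIV B \<and> (finite B \<longrightarrow> n \<le> card B))"

definition points :: "'b set set"
  where "points = {P. subspace_of_dim 1 P}"

definition lines :: "'b set set set"
  where "lines = {{P \<in> points. P \<subseteq> W} | W. subspace_of_dim 2 W}"

definition collinear :: "'b set \<Rightarrow> 'b set \<Rightarrow> 'b set \<Rightarrow> bool"
  where "collinear P Q S \<longleftrightarrow> (\<exists>L\<in>lines. P \<in> L \<and> Q \<in> L \<and> S \<in> L)"

definition GL :: "('b \<Rightarrow> 'b) set"
  where "GL = {u. bij u \<and> (\<forall>x y. u (x + y) = u x + u y) \<and> (\<forall>a x. u (a *s x) = a *s u x)}"

text \<open>Restricting to \<^term>\<open>points\<close> makes the elements of \<open>PGL\<close> maps on the projective space only.\<close>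

definition PGL :: "('b set \<Rightarrow> 'b set) set"
  where "PGL = {restrict (\<lambda>P. u ` P) points | u. u \<in> GL}"

end

definition PGL_mapping ::
  "('a::division_ring \<Rightarrow> 'b::ab_group_add \<Rightarrow> 'b) \<Rightarrow> ('c::division_ring \<Rightarrow> 'd::ab_group_add \<Rightarrow> 'd)
    \<Rightarrow> ('b set \<Rightarrow> 'd set) \<Rightarrow> bool"
  where "PGL_mapping s s' f \<longleftrightarrow>
    f \<in> left_vector_space.points s \<rightarrow> left_vector_space.points s' \<and>
    (\<forall>h \<in> left_vector_space.PGL s. \<exists>h' \<in> left_vector_space.PGL s'.
      \<forall>P \<in> left_vector_space.points s. f (h P) = h' (f P))"

definition PGL_bijection ::
  "('a::division_ring \<Rightarrow> 'b::ab_group_add \<Rightarrow> 'b) \<Rightarrow> ('c::division_ring \<Rightarrow> 'd::ab_group_add \<Rightarrow> 'd)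
    \<Rightarrow> ('b set \<Rightarrow> 'd set) \<Rightarrow> bool"
  where "PGL_bijection s s' f \<longleftrightarrow>
    PGL_mapping s s' f \<and>
    bij_betw f (left_vector_space.points s) (left_vector_space.points s')"

definition semicollineation ::
  "('a::division_ring \<Rightarrow> 'b::ab_group_add \<Rightarrow> 'b) \<Rightarrow> ('c::division_ring \<Rightarrow> 'd::ab_group_add \<Rightarrow> 'd)
    \<Rightarrow> ('b set \<Rightarrow> 'd set) \<Rightarrow> bool"
  where "semicollineation s s' g \<longleftrightarrow>
    bij_betw g (left_vector_space.points s) (left_vector_space.points s') \<and>
    (\<forall>P \<in> left_vector_space.points s. \<forall>Q \<in> left_vector_space.points s.
     \<forall>S \<in> left_vector_space.points s.
      P \<noteq> Q \<and> Q \<noteq> S \<and> P \<noteq> S \<and> left_vector_space.collinear s P Q S \<longrightarrow>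
      left_vector_space.collinear s' (g P) (g Q) (g S))"

end

theory Submission imports Defs "HOL-Library.Set_Algebras" begin

text \<open>
  Suppose that points \<open>P\<close>, \<open>Q\<close>, \<open>S\<close> are not collinear, but that their images under \<open>f\<close> lie in a
  common plane \<open>W\<close> (a \<open>2\<close>-dimensional subspace, that is, a projective line). For every point \<open>X\<close> off
  the line \<open>PQ\<close> there is a transvection of \<open>V\<close> that fixes all vectors of \<open>P + Q\<close> and moves \<open>S\<close> to \<open>X\<close>
  (\<open>GL_fixing_subspace_transitive\<close>). Conjugation by \<open>f\<close> turns it into an element of \<open>PGL(V')\<close> that
  fixes \<open>f P\<close> and \<open>f Q\<close>. These two distinct points span \<open>W\<close>, so \<open>W\<close> is mapped to itself, and \<open>f X\<close>,
  the image of \<open>f S\<close>, lies in \<open>W\<close> (\<open>plane_absorbs_image\<close>).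

  Exchanging \<open>Q\<close> and \<open>S\<close> gives the same conclusion for all \<open>X\<close> off the line \<open>PS\<close>. The lines \<open>PQ\<close> and
  \<open>PS\<close> meet only in \<open>P\<close>, so \<open>f\<close> maps every point into \<open>W\<close>. As \<open>V'\<close> has dimension at least \<open>3\<close>, this
  contradicts surjectivity. Hence collinear images can come only from collinear points, which is
  the claim about the inverse of \<open>f\<close>.

  What this needs over a division ring is the theory of points and planes, based on an exchange
  property (\<open>point_exchange\<close>), and enough linear functionals to write down the transvections; the
  latter come from hyperplanes provided by Zorn's lemma. The subspace generated by two subspaces is
  their elementwise sum \<open>A + B\<close>.
\<close>

section \<open>Scalars and subspaces\<close>

context left_vector_space
begin

lemma scale_zero_left [simp]: "0 *s x = 0"
  using scale_left_distrib[of 0 0 x] by simp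

lemma scale_zero_right [simp]: "a *s 0 = 0"
  using scale_right_distrib[of a 0 0] by simp

lemma scale_minus_left: "(- a) *s x = - (a *s x)"
  using scale_left_distrib[of "- a" a x] by (simp add: eq_neg_iff_add_eq_0)

lemma scale_minus_right: "a *s (- x) = - (a *s x)"
  using scale_right_distrib[of a "- x" x] by (simp add: eq_neg_iff_add_eq_0)

lemma scale_diff_right: "a *s (x - y) = a *s x - a *s y"
  using scale_right_distrib[of a x "- y"] by (simp add: scale_minus_right)

lemma scale_diff_left: "(a - b) *s x = a *s x - b *s x"
  using scale_left_distrib[of a "- b" x] by (simp add: scale_minus_left)

lemma scale_inverse_cancel: "a \<noteq> 0 \<Longrightarrow> inverse a *s (a *s x) = x"
  by (simp add: scale_scale scale_one)

lemma scale_eq_0_iff [simp]: "a *s x = 0 \<longleftrightarrow> a = 0 \<or> x = 0"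
proof
  assume "a *s x = 0"
  then have "a \<noteq> 0 \<Longrightarrow> x = 0" using scale_inverse_cancel[of a x] by simp
  then show "a = 0 \<or> x = 0" by blast
qed auto

definition subspace :: "'b set \<Rightarrow> bool"
  where "subspace W \<longleftrightarrow> 0 \<in> W \<and> (\<forall>x\<in>W. \<forall>y\<in>W. x + y \<in> W) \<and> (\<forall>a. \<forall>x\<in>W. a *s x \<in> W)"

lemma subspaceD:
  assumes "subspace W"
  shows subspace_0: "0 \<in> W"
    and subspace_add: "x \<in> W \<Longrightarrow> y \<in> W \<Longrightarrow> x + y \<in> W"
    and subspace_scale: "x \<in> W \<Longrightarrow> a *s x \<in> W"
  using assms by (auto simp: subspace_def)

lemma subspace_diff: "subspace W \<Longrightarrow> x \<in> W \<Longrightarrow> y \<in> W \<Longrightarrow> x - y \<in> W"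
  using subspace_add[of W x "(- 1) *s y"] subspace_scale[of W y "- 1"]
  by (simp add: scale_minus_left scale_one)

lemma subspace_scale_iff:
  assumes "subspace W" "a \<noteq> 0"
  shows "a *s x \<in> W \<longleftrightarrow> x \<in> W"
proof
  assume "a *s x \<in> W"
  then show "x \<in> W"
    using subspace_scale[OF assms(1), of "a *s x" "inverse a"] assms(2)
    by (simp add: scale_inverse_cancel)
qed (rule subspace_scale[OF assms(1)])

lemma subspace_plus:
  assumes "subspace A" "subspace B"
  shows "subspace (A + B)"
  unfolding subspace_def
proof (intro conjI ballI allI)
  show "0 \<in> A + B"
    using set_plus_intro[OF subspace_0 subspace_0, OF assms] by simp
next
  fix x y assume "x \<in> A + B" "y \<in> A + B"
  then obtain a b a' b' where "a \<in> A" "b \<in> B" "a' \<in> A" "b' \<in> B" "x = a + b" "y = a' + b'"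
    by (auto elim!: set_plus_elim)
  moreover from this have "(a + a') + (b + b') \<in> A + B"
    using assms subspace_add by blast
  ultimately show "x + y \<in> A + B"
    by (simp add: algebra_simps)
next
  fix c x assume "x \<in> A + B"
  then show "c *s x \<in> A + B"
    by (elim set_plus_elim)
      (simp add: scale_right_distrib set_plus_intro subspace_scale[OF assms(1)]
        subspace_scale[OF assms(2)])
qed

lemma plus_subset_subspace: "subspace W \<Longrightarrow> A \<subseteq> W \<Longrightarrow> B \<subseteq> W \<Longrightarrow> A + B \<subseteq> W"
  by (auto elim!: set_plus_elim intro!: subspace_add)

lemma subset_plus:
  assumes "subspace A" "subspace B"
  shows "A \<subseteq> A + B" "B \<subseteq> A + B"
proof -
  show "A \<subseteq> A + B"
    using set_plus_intro[OF _ subspace_0[OF assms(2)], of _ A] by (simp add: subset_iff)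
  show "B \<subseteq> A + B"
    using set_plus_intro[OF subspace_0[OF assms(1)], of _ B] by (simp add: subset_iff)
qed

definition ray :: "'b \<Rightarrow> 'b set"
  where "ray v = range (\<lambda>a. a *s v)"

lemma subspace_ray: "subspace (ray v)"
  unfolding subspace_def ray_def
proof (intro conjI ballI allI)
  show "0 \<in> range (\<lambda>a. a *s v)"
    by (rule range_eqI[of _ _ 0]) simp
next
  fix x y assume "x \<in> range (\<lambda>a. a *s v)" "y \<in> range (\<lambda>a. a *s v)"
  then show "x + y \<in> range (\<lambda>a. a *s v)"
    by (auto simp: scale_left_distrib[symmetric])
next
  fix c x assume "x \<in> range (\<lambda>a. a *s v)"
  then show "c *s x \<in> range (\<lambda>a. a *s v)"
    by (auto simp: scale_scale)
qed

lemma self_in_ray: "v \<in> ray v"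
  unfolding ray_def by (rule range_eqI[of _ _ 1]) (simp add: scale_one)

lemma ray_subset_iff: "subspace W \<Longrightarrow> ray v \<subseteq> W \<longleftrightarrow> v \<in> W"
  using self_in_ray[of v] subspace_scale[of W v] by (auto simp: ray_def)

lemma ray_scale:
  assumes "a \<noteq> 0"
  shows "ray (a *s v) = ray v"
proof
  show "ray (a *s v) \<subseteq> ray v"
    using ray_subset_iff[OF subspace_ray] subspace_scale[OF subspace_ray self_in_ray] by blast
  have "v \<in> ray (a *s v)"
    using subspace_scale_iff[OF subspace_ray assms] self_in_ray by blast
  then show "ray v \<subseteq> ray (a *s v)"
    using ray_subset_iff[OF subspace_ray] by blast
qed

lemma ray_eqI:
  assumes "x \<in> ray v" "x \<noteq> 0"
  shows "ray x = ray v"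
proof -
  obtain a where "x = a *s v" using assms(1) by (auto simp: ray_def)
  then show ?thesis using assms(2) ray_scale by auto
qed

section \<open>Points, planes and collinearity\<close>

text \<open>A linear combination over a subset of \<open>B\<close> can be padded with zero coefficients.\<close>

lemma span_finite:
  assumes "finite B"
  shows "span B = range (\<lambda>c. \<Sum>v\<in>B. c v *s v)"
proof (intro equalityI subsetI)
  fix x assume "x \<in> span B"
  then obtain t c where tc: "finite t" "t \<subseteq> B" "x = (\<Sum>v\<in>t. c v *s v)"
    unfolding span_def by blast
  have "x = (\<Sum>v\<in>B. (if v \<in> t then c v else 0) *s v)"
    unfolding tc(3) by (rule sum.mono_neutral_cong_left[OF assms tc(2)]) auto
  then show "x \<in> range (\<lambda>c. \<Sum>v\<in>B. c v *s v)"
    by (rule range_eqI[where x = "\<lambda>v. if v \<in> t then c v else 0"])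
next
  fix x assume "x \<in> range (\<lambda>c. \<Sum>v\<in>B. c v *s v)"
  then show "x \<in> span B"
    unfolding span_def using assms by blast
qed

lemma span_singleton: "span {v} = ray v"
proof (subst span_finite, simp, intro equalityI subsetI)
  fix x assume "x \<in> ray v"
  then obtain a where "x = a *s v" by (auto simp: ray_def)
  then show "x \<in> range (\<lambda>c. \<Sum>w\<in>{v}. c w *s w)"
    by (intro range_eqI[where x = "\<lambda>_. a"]) simp
qed (auto simp: ray_def)

lemma span_pair:
  assumes "v \<noteq> w"
  shows "span {v, w} = ray v + ray w"
proof (subst span_finite, simp, intro equalityI subsetI)
  fix x assume "x \<in> range (\<lambda>c. \<Sum>y\<in>{v, w}. c y *s y)"
  then show "x \<in> ray v + ray w"
    using assms by (auto simp: ray_def intro!: set_plus_intro)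
next
  fix x assume "x \<in> ray v + ray w"
  then obtain a b where "x = a *s v + b *s w"
    by (auto simp: ray_def elim!: set_plus_elim)
  then show "x \<in> range (\<lambda>c. \<Sum>y\<in>{v, w}. c y *s y)"
    using assms by (intro range_eqI[where x = "\<lambda>y. if y = v then a else b"]) simp
qed

lemma independent_mono: "independent B \<Longrightarrow> A \<subseteq> B \<Longrightarrow> independent A"
  unfolding independent_def by blast

lemma independent_singleton: "independent {v} \<longleftrightarrow> v \<noteq> 0"
proof
  assume ind: "independent {v}"
  show "v \<noteq> 0"
  proof
    assume "v = 0"
    then have "(\<Sum>w\<in>{v}. (\<lambda>_. 1) w *s w) = 0" by simp
    then have "(1::'a) = 0"
      using ind[unfolded independent_def, rule_format, of "{v}" "\<lambda>_. 1" v] by simp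
    then show False by simp
  qed
next
  assume "v \<noteq> 0"
  then show "independent {v}"
    unfolding independent_def by (auto simp: subset_singleton_iff)
qed

lemma independent_not_in_span:
  assumes "independent (insert v B)" "v \<notin> B"
  shows "v \<notin> span B"
proof
  assume "v \<in> span B"
  then obtain t c where tc: "finite t" "t \<subseteq> B" "v = (\<Sum>w\<in>t. c w *s w)"
    unfolding span_def by blast
  let ?c = "\<lambda>w. if w = v then - 1 else c w"
  have "v \<notin> t" using tc(2) assms(2) by blast
  then have "(\<Sum>w\<in>t. ?c w *s w) = (\<Sum>w\<in>t. c w *s w)"
    by (intro sum.cong) auto
  then have "(\<Sum>w\<in>insert v t. ?c w *s w) = 0"
    using tc \<open>v \<notin> t\<close> by (simp add: scale_minus_left scale_one)
  moreover have "finite (insert v t)" "insert v t \<subseteq> insert v B"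
    using tc by auto
  ultimately have "?c v = 0"
    using assms(1)[unfolded independent_def, rule_format, of "insert v t" ?c v] by blast
  then show False by simp
qed

lemma independent_pairI:
  assumes "v \<notin> ray w" "w \<noteq> 0"
  shows "independent {v, w}"
  unfolding independent_def
proof (intro allI impI, elim conjE)
  fix t :: "'b set" and c :: "'b \<Rightarrow> 'a"
  assume t: "finite t" "t \<subseteq> {v, w}" "(\<Sum>x\<in>t. c x *s x) = 0"
  have vw: "v \<noteq> w" using assms self_in_ray by blast
  define d where "d x = (if x \<in> t then c x else 0)" for x
  have "(\<Sum>x\<in>{v, w}. d x *s x) = (\<Sum>x\<in>t. c x *s x)"
    by (rule sum.mono_neutral_cong_right) (use t in \<open>auto simp: d_def\<close>)
  then have eq: "d v *s v + d w *s w = 0"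
    using vw t by simp
  have "d v = 0"
  proof (rule ccontr)
    assume "d v \<noteq> 0"
    have "d v *s v = (- d w) *s w"
      using eq by (simp add: scale_minus_left eq_neg_iff_add_eq_0)
    then have "d v *s v \<in> ray w" by (auto simp: ray_def)
    then show False
      using subspace_scale_iff[OF subspace_ray \<open>d v \<noteq> 0\<close>] assms(1) by blast
  qed
  moreover from this have "d w = 0" using eq assms(2) by simp
  ultimately show "\<forall>x\<in>t. c x = 0"
    using t(2) by (auto simp: d_def split: if_splits)
qed

lemma point_iff: "P \<in> points \<longleftrightarrow> (\<exists>v. v \<noteq> 0 \<and> P = ray v)"
proof
  assume "P \<in> points"
  then show "\<exists>v. v \<noteq> 0 \<and> P = ray v"
    unfolding points_def subspace_of_dim_def basis_of_def
    by (auto simp: card_1_singleton_iff independent_singleton span_singleton)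
next
  assume "\<exists>v. v \<noteq> 0 \<and> P = ray v"
  then obtain v where "v \<noteq> 0" "P = ray v" by blast
  then show "P \<in> points"
    unfolding points_def subspace_of_dim_def basis_of_def
    using independent_singleton span_singleton by (intro CollectI exI[of _ "{v}"]) simp
qed

lemma subspace_point: "P \<in> points \<Longrightarrow> subspace P"
  by (auto simp: point_iff subspace_ray)

lemma point_eq_ray: "P \<in> points \<Longrightarrow> x \<in> P \<Longrightarrow> x \<noteq> 0 \<Longrightarrow> P = ray x"
  by (auto simp: point_iff ray_eqI)

lemma point_subset_point: "P \<in> points \<Longrightarrow> Q \<in> points \<Longrightarrow> P \<subseteq> Q \<Longrightarrow> P = Q"
  using point_eq_ray self_in_ray by (metis point_iff subsetD)

text \<open>
  From here on the planes of \<open>V\<close> are handled through points alone; bases are needed again only to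
  bound the dimension from below.
\<close>

lemma plane_iff:
  "subspace_of_dim 2 W \<longleftrightarrow> (\<exists>P\<in>points. \<exists>Q\<in>points. P \<noteq> Q \<and> W = P + Q)"
proof
  assume "subspace_of_dim 2 W"
  then obtain v w where vw: "v \<noteq> w" "independent {v, w}" "W = span {v, w}"
    unfolding subspace_of_dim_def basis_of_def by (auto simp: card_2_iff)
  have "v \<noteq> 0" "w \<noteq> 0"
    using independent_mono[OF vw(2)] independent_singleton by blast+
  moreover have "v \<notin> ray w"
    using independent_not_in_span[OF vw(2)] vw(1) by (simp add: span_singleton)
  then have "ray v \<noteq> ray w" using self_in_ray by blast
  ultimately show "\<exists>P\<in>points. \<exists>Q\<in>points. P \<noteq> Q \<and> W = P + Q"
    using span_pair[OF vw(1)] vw(3) point_iff by blast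
next
  assume "\<exists>P\<in>points. \<exists>Q\<in>points. P \<noteq> Q \<and> W = P + Q"
  then obtain v w where vw: "v \<noteq> 0" "w \<noteq> 0" "ray v \<noteq> ray w" "W = ray v + ray w"
    by (metis point_iff)
  then have "v \<notin> ray w" using ray_eqI by blast
  then have "independent {v, w}" "v \<noteq> w"
    using independent_pairI vw(2) self_in_ray by blast+
  then show "subspace_of_dim 2 W"
    unfolding subspace_of_dim_def basis_of_def using span_pair vw(4)
    by (intro exI[of _ "{v, w}"]) auto
qed

text \<open>
  The Steinitz exchange step. A vector of \<open>P\<close> outside \<open>A\<close> has a nonzero component in \<open>B\<close>, and this
  component generates the whole point \<open>B\<close>.
\<close>

lemma point_exchange:
  assumes A: "subspace A" and B: "B \<in> points" and P: "P \<in> points"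
    and "P \<subseteq> A + B" "\<not> P \<subseteq> A"
  shows "B \<subseteq> A + P"
proof -
  obtain p where p: "p \<in> P" "p \<notin> A" using assms by blast
  then have "p \<in> A + B" using assms by blast
  then obtain a b where ab: "a \<in> A" "b \<in> B" "p = a + b"
    by (rule set_plus_elim)
  then have "b \<noteq> 0" using p by auto
  then have "B = ray b" using point_eq_ray B ab by blast
  moreover have "b = (- 1) *s a + p"
    using ab by (simp add: scale_minus_left scale_one)
  then have "b \<in> A + P"
    using subspace_scale[OF A ab(1)] p(1) set_plus_intro by metis
  ultimately show ?thesis
    using ray_subset_iff subspace_plus A subspace_point[OF P] by metis
qed

text \<open>
  Two points determine the line through them: exchanging first \<open>P\<close> and then \<open>Q\<close> for the two points
  that generate \<open>W\<close> does not change the plane.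
\<close>

lemma plane_eq_plus_points:
  assumes W: "subspace_of_dim 2 W" and P: "P \<in> points" "P \<subseteq> W" and Q: "Q \<in> points" "Q \<subseteq> W"
    and "P \<noteq> Q"
  shows "P + Q = W"
proof -
  obtain A B where AB: "A \<in> points" "B \<in> points" "W = A + B"
    using W plane_iff by blast
  note sub = subspace_point[OF AB(1)] subspace_point[OF AB(2)]
    subspace_point[OF P(1)] subspace_point[OF Q(1)]
  have sW: "subspace W" using AB sub subspace_plus by blast
  \<comment> \<open>\<open>C\<close> is the generator of \<open>W\<close> that remains after \<open>P\<close> has replaced the other one.\<close>
  obtain C where C: "C \<in> points" "W \<subseteq> P + C"
  proof (cases "P = A")
    case True
    then show ?thesis using that AB by blast
  next
    case False
    then have "B \<subseteq> A + P"
      using point_exchange[OF sub(1) AB(2) P(1)] P(2) AB point_subset_point P(1) by blast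
    then have "W \<subseteq> P + A"
      unfolding AB(3) using sub subset_plus subspace_plus
      by (intro plus_subset_subspace) (auto simp: add.commute)
    then show ?thesis using that AB by blast
  qed
  have "\<not> Q \<subseteq> P" using point_subset_point P Q \<open>P \<noteq> Q\<close> by blast
  then have "C \<subseteq> P + Q"
    using point_exchange[OF sub(3) C(1) Q(1)] C Q(2) by blast
  then have "P + C \<subseteq> P + Q"
    using sub subset_plus subspace_plus by (intro plus_subset_subspace) auto
  moreover have "P + Q \<subseteq> W" using sW P Q plus_subset_subspace by blast
  ultimately show ?thesis using C by blast
qed

lemma collinear_iff:
  assumes "P \<in> points" "Q \<in> points" "S \<in> points" "P \<noteq> Q"
  shows "collinear P Q S \<longleftrightarrow> S \<subseteq> P + Q"
proof -
  have "collinear P Q S \<longleftrightarrow> (\<exists>W. subspace_of_dim 2 W \<and> P \<subseteq> W \<and> Q \<subseteq> W \<and> S \<subseteq> W)"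
    using assms unfolding collinear_def lines_def by auto
  also have "\<dots> \<longleftrightarrow> S \<subseteq> P + Q"
  proof
    assume "S \<subseteq> P + Q"
    moreover have "subspace_of_dim 2 (P + Q)" using assms plane_iff by blast
    ultimately show "\<exists>W. subspace_of_dim 2 W \<and> P \<subseteq> W \<and> Q \<subseteq> W \<and> S \<subseteq> W"
      using subset_plus[OF subspace_point subspace_point] assms by blast
  qed (use plane_eq_plus_points assms in blast)
  finally show ?thesis .
qed

text \<open>
  Three independent vectors cannot lie in one plane: the first two would already generate it, and
  the third would depend on them.
\<close>

lemma plane_neq_UNIV:
  assumes "dim_at_least 3" "subspace_of_dim 2 W"
  shows "W \<noteq> UNIV"
proof
  assume "W = UNIV"
  obtain B where B: "independent B" "finite B \<longrightarrow> 3 \<le> card B"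
    using assms(1) unfolding dim_at_least_def basis_of_def by blast
  obtain T where "T \<subseteq> B" "card T = 3"
  proof (cases "finite B")
    case True
    then show ?thesis using B obtain_subset_with_card_n that by metis
  next
    case False
    then show ?thesis using infinite_arbitrarily_large that by metis
  qed
  then obtain a b c where abc: "{a, b, c} \<subseteq> B" "a \<noteq> b" "a \<noteq> c" "b \<noteq> c"
    by (auto simp: card_3_iff)
  have ind: "independent {c, a, b}"
    by (rule independent_mono[OF B(1)]) (use abc in blast)
  then have nz: "a \<noteq> 0" "b \<noteq> 0" and "independent {a, b}"
    using independent_mono independent_singleton by blast+
  then have "a \<notin> ray b"
    using independent_not_in_span[of a "{b}"] abc by (simp add: span_singleton)
  then have "ray a \<noteq> ray b" using self_in_ray by blast
  moreover have "ray a \<in> points" "ray b \<in> points"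
    using nz point_iff by blast+
  ultimately have "ray a + ray b = UNIV"
    using plane_eq_plus_points[OF assms(2)] \<open>W = UNIV\<close> by blast
  then show False
    using independent_not_in_span[OF ind] abc span_pair[of a b] by auto
qed

section \<open>Linear functionals and transvections\<close>

definition functional :: "('b \<Rightarrow> 'a) \<Rightarrow> bool"
  where "functional \<phi> \<longleftrightarrow> (\<forall>x y. \<phi> (x + y) = \<phi> x + \<phi> y) \<and> (\<forall>a x. \<phi> (a *s x) = a * \<phi> x)"

lemma subspace_Union_chain:
  assumes "C \<in> chains \<C>" "C \<noteq> {}" "\<And>W. W \<in> C \<Longrightarrow> subspace W"
  shows "subspace (\<Union>C)"
  unfolding subspace_def
proof (intro conjI ballI allI)
  show "0 \<in> \<Union>C" using assms subspace_0 by blast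
next
  fix x y assume "x \<in> \<Union>C" "y \<in> \<Union>C"
  then obtain X Y where XY: "X \<in> C" "Y \<in> C" "x \<in> X" "y \<in> Y" by blast
  then have "X \<subseteq> Y \<or> Y \<subseteq> X"
    using assms(1) unfolding chains_def chain_subset_def by blast
  then show "x + y \<in> \<Union>C"
    using XY assms(3) subspace_add by blast
next
  fix a x assume "x \<in> \<Union>C"
  then show "a *s x \<in> \<Union>C" using assms(3) subspace_scale by blast
qed

text \<open>
  A subspace \<open>H\<close> that is maximal among those containing \<open>W\<close> but not \<open>r\<close> is a hyperplane: enlarging
  \<open>H\<close> by any other \<open>x\<close> captures \<open>r\<close>, and exchange then recovers \<open>x\<close> from \<open>H\<close> and \<open>r\<close>.
\<close>

lemma complementary_hyperplane:
  assumes "subspace W" "r \<notin> W"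
  obtains H where "subspace H" "W \<subseteq> H" "r \<notin> H" "H + ray r = UNIV"
proof -
  let ?A = "{H. subspace H \<and> W \<subseteq> H \<and> r \<notin> H}"
  have "\<exists>U\<in>?A. \<forall>X\<in>C. X \<subseteq> U" if C: "C \<in> chains ?A" for C
  proof (cases "C = {}")
    case True
    then show ?thesis using assms by blast
  next
    case False
    have "C \<subseteq> ?A" using C by (simp add: chains_def)
    then show ?thesis
      using subspace_Union_chain[OF C False] False by (intro bexI[of _ "\<Union>C"]) auto
  qed
  then have "\<exists>M\<in>?A. \<forall>X\<in>?A. M \<subseteq> X \<longrightarrow> X = M"
    by (intro Zorn_Lemma2) blast
  then obtain H where H: "subspace H" "W \<subseteq> H" "r \<notin> H"
    and max: "\<And>X. subspace X \<Longrightarrow> r \<notin> X \<Longrightarrow> H \<subseteq> X \<Longrightarrow> X = H"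
    by auto
  have "x \<in> H + ray r" for x
  proof (cases "x \<in> H")
    case True
    then show ?thesis using subset_plus(1)[OF H(1) subspace_ray] by blast
  next
    case False
    have sub: "subspace (H + ray x)" using H subspace_plus subspace_ray by blast
    have xH: "x \<in> H + ray x"
      using subset_plus(2)[OF H(1) subspace_ray] self_in_ray by blast
    have "r \<in> H + ray x"
      using max[OF sub] subset_plus(1)[OF H(1) subspace_ray] xH False by blast
    then have "ray r \<subseteq> H + ray x" using ray_subset_iff[OF sub] by blast
    moreover have "x \<noteq> 0" "r \<noteq> 0" using False H subspace_0 by blast+
    then have "ray x \<in> points" "ray r \<in> points" using point_iff by blast+
    moreover have "\<not> ray r \<subseteq> H" using H self_in_ray by blast
    ultimately have "ray x \<subseteq> H + ray r" using point_exchange[OF H(1)] by blast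
    then show ?thesis using self_in_ray by blast
  qed
  then show thesis using that[OF H] by blast
qed

text \<open>The functional reads off the coefficient of \<open>r\<close> in the decomposition along the hyperplane.\<close>

lemma functional_separating:
  assumes "subspace W" "r \<notin> W"
  obtains \<phi> where "functional \<phi>" "\<And>x. x \<in> W \<Longrightarrow> \<phi> x = 0" "\<phi> r = 1"
proof -
  obtain H where H: "subspace H" "W \<subseteq> H" "r \<notin> H" "H + ray r = UNIV"
    using complementary_hyperplane[OF assms] .
  have ex: "\<exists>a. x - a *s r \<in> H" for x
  proof -
    have "x \<in> H + ray r" using H(4) by simp
    then obtain h a where "h \<in> H" "x = h + a *s r"
      by (auto simp: ray_def elim!: set_plus_elim)
    then show ?thesis by (intro exI[of _ a]) simp
  qed
  have uniq: "a = b" if "x - a *s r \<in> H" "x - b *s r \<in> H" for x a b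
  proof (rule ccontr)
    assume "a \<noteq> b"
    have "(a - b) *s r = (x - b *s r) - (x - a *s r)" by (simp add: scale_diff_left)
    then have "(a - b) *s r \<in> H" using subspace_diff[OF H(1) that(2) that(1)] by simp
    then show False using subspace_scale_iff[OF H(1)] \<open>a \<noteq> b\<close> H(3) by simp
  qed
  define \<phi> where "\<phi> x = (THE a. x - a *s r \<in> H)" for x
  have \<phi>_in: "x - \<phi> x *s r \<in> H" for x
    unfolding \<phi>_def using ex uniq by (metis the_equality)
  have \<phi>_eq: "\<phi> x = a" if "x - a *s r \<in> H" for x a
    using uniq[OF \<phi>_in that] .
  have "\<phi> (x + y) = \<phi> x + \<phi> y" for x y
  proof (rule \<phi>_eq)
    have "x + y - (\<phi> x + \<phi> y) *s r = (x - \<phi> x *s r) + (y - \<phi> y *s r)"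
      by (simp add: scale_left_distrib algebra_simps)
    then show "x + y - (\<phi> x + \<phi> y) *s r \<in> H"
      using subspace_add[OF H(1) \<phi>_in \<phi>_in] by metis
  qed
  moreover have "\<phi> (a *s x) = a * \<phi> x" for a x
  proof (rule \<phi>_eq)
    have "a *s x - (a * \<phi> x) *s r = a *s (x - \<phi> x *s r)"
      by (simp add: scale_diff_right scale_scale)
    then show "a *s x - (a * \<phi> x) *s r \<in> H"
      using subspace_scale[OF H(1) \<phi>_in] by simp
  qed
  ultimately have "functional \<phi>" unfolding functional_def by blast
  moreover have "\<phi> x = 0" if "x \<in> W" for x
    by (rule \<phi>_eq) (use that H in auto)
  moreover have "\<phi> r = 1"
    by (rule \<phi>_eq) (use subspace_0[OF H(1)] in \<open>simp add: scale_one\<close>)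
  ultimately show thesis by (rule that)
qed

text \<open>
  If functionals that separate \<open>p\<close> and \<open>q\<close> from \<open>W\<close> each vanish at the other vector, then their sum
  vanishes at neither; otherwise one of them already serves.
\<close>

lemma functional_separating_two:
  assumes "subspace W" "p \<notin> W" "q \<notin> W"
  obtains \<phi> where "functional \<phi>" "\<And>x. x \<in> W \<Longrightarrow> \<phi> x = 0" "\<phi> p \<noteq> 0" "\<phi> q \<noteq> 0"
proof -
  obtain \<alpha> where \<alpha>: "functional \<alpha>" "\<And>x. x \<in> W \<Longrightarrow> \<alpha> x = 0" "\<alpha> p = 1"
    using functional_separating[OF assms(1,2)] by blast
  obtain \<beta> where \<beta>: "functional \<beta>" "\<And>x. x \<in> W \<Longrightarrow> \<beta> x = 0" "\<beta> q = 1"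
    using functional_separating[OF assms(1,3)] by blast
  show thesis
  proof (cases "\<alpha> q = 0 \<and> \<beta> p = 0")
    case True
    have "functional (\<lambda>x. \<alpha> x + \<beta> x)"
      using \<alpha>(1) \<beta>(1) by (simp add: functional_def algebra_simps)
    then show thesis by (rule that) (use True \<alpha> \<beta> in auto)
  next
    case False
    then show thesis using that[of \<alpha>] that[of \<beta>] \<alpha> \<beta> by fastforce
  qed
qed

lemma transvection_in_GL:
  assumes "functional \<phi>" "\<phi> d = 0"
  shows "(\<lambda>x. x + \<phi> x *s d) \<in> GL"
proof -
  have lin: "\<phi> (x + y) = \<phi> x + \<phi> y" "\<phi> (a *s x) = a * \<phi> x" for x y a
    using assms(1) by (auto simp: functional_def)
  \<comment> \<open>Adding multiples of \<open>d\<close> does not change \<open>\<phi>\<close>, so subtracting \<open>\<phi> x *s d\<close> undoes the map.\<close>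
  have shift: "\<phi> (x + a *s d) = \<phi> x" for x a
    by (simp add: lin assms(2))
  have "bij (\<lambda>x. x + \<phi> x *s d)"
    by (rule o_bij[of "\<lambda>x. x + (- \<phi> x) *s d"])
      (simp_all only: fun_eq_iff o_apply shift, simp_all add: scale_minus_left)
  then show ?thesis
    by (auto simp: GL_def lin scale_left_distrib scale_right_distrib scale_scale algebra_simps)
qed

lemma GL_image_ray:
  assumes "u \<in> GL"
  shows "u ` ray v = ray (u v)"
  using assms by (auto simp: GL_def ray_def image_image)

lemma GL_image_plus:
  assumes "u \<in> GL"
  shows "u ` (A + B) = u ` A + u ` B"
proof -
  have add: "u (x + y) = u x + u y" for x y
    using assms by (simp add: GL_def)
  show ?thesis
    unfolding set_plus_image by (force simp: add)
qed

text \<open>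
  Rescale generators \<open>p\<close> of \<open>P\<close> and \<open>q\<close> of \<open>Q\<close> so that a functional \<open>\<phi>\<close> vanishing on \<open>W\<close> takes the
  value \<open>1\<close> at both. Then \<open>q - p\<close> lies in the kernel of \<open>\<phi>\<close>, and the transvection along \<open>q - p\<close> sends
  \<open>p\<close> to \<open>q\<close>. One construction thus serves whether or not \<open>Q\<close> lies in \<open>W + P\<close>.
\<close>

lemma GL_fixing_subspace_transitive:
  assumes "subspace W" "P \<in> points" "Q \<in> points" "\<not> P \<subseteq> W" "\<not> Q \<subseteq> W"
  obtains u where "u \<in> GL" "\<And>x. x \<in> W \<Longrightarrow> u x = x" "u ` P = Q"
proof -
  obtain p q where pq: "P = ray p" "Q = ray q"
    using assms(2,3) by (auto simp: point_iff)
  then have "p \<notin> W" "q \<notin> W" using assms ray_subset_iff by blast+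
  then obtain \<phi> where \<phi>: "functional \<phi>" "\<And>x. x \<in> W \<Longrightarrow> \<phi> x = 0" "\<phi> p \<noteq> 0" "\<phi> q \<noteq> 0"
    using functional_separating_two[OF assms(1)] by blast
  define p' q' where "p' = inverse (\<phi> p) *s p" and "q' = inverse (\<phi> q) *s q"
  have rays: "P = ray p'" "Q = ray q'"
    using pq \<phi> ray_scale by (simp_all add: p'_def q'_def)
  have one: "\<phi> p' = 1" "\<phi> q' = 1"
    using \<phi> by (simp_all add: p'_def q'_def functional_def)
  have "\<phi> (q' - p') + \<phi> p' = \<phi> q'"
    using \<phi>(1) unfolding functional_def by (metis diff_add_cancel)
  then have d: "\<phi> (q' - p') = 0" using one by simp
  let ?u = "\<lambda>x. x + \<phi> x *s (q' - p')"
  have u: "?u \<in> GL" using transvection_in_GL[OF \<phi>(1) d] .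
  moreover have "?u x = x" if "x \<in> W" for x using \<phi>(2)[OF that] by simp
  moreover have "?u ` P = Q"
    using GL_image_ray[OF u] rays one by (simp add: scale_one)
  ultimately show thesis by (rule that)
qed

end

section \<open>Noncollinear points with collinear images\<close>

text \<open>
  The transvection that fixes \<open>P + Q\<close> and takes \<open>S\<close> to \<open>X\<close> corresponds under \<open>f\<close> to a linear
  automorphism preserving \<open>f P\<close> and \<open>f Q\<close>, hence \<open>W\<close>; it takes \<open>f S\<close>, which is contained in \<open>W\<close>,
  to \<open>f X\<close>.
\<close>

lemma plane_absorbs_image:
  assumes "left_vector_space s" "left_vector_space s'" and f: "PGL_bijection s s' f"
    and pts: "P \<in> left_vector_space.points s" "Q \<in> left_vector_space.points s"
      "S \<in> left_vector_space.points s"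
    and "P \<noteq> Q" "\<not> S \<subseteq> P + Q"
    and W: "left_vector_space.subspace_of_dim s' 2 W" "f P \<subseteq> W" "f Q \<subseteq> W" "f S \<subseteq> W"
    and X: "X \<in> left_vector_space.points s" "\<not> X \<subseteq> P + Q"
  shows "f X \<subseteq> W"
proof -
  interpret V: left_vector_space s by fact
  interpret V': left_vector_space s' by fact
  have bij: "bij_betw f V.points V'.points" and map: "PGL_mapping s s' f"
    using f by (auto simp: PGL_bijection_def)
  have f_pts: "f P \<in> V'.points" "f Q \<in> V'.points" "f S \<in> V'.points"
    using bij pts by (auto simp: bij_betw_def)
  have sub: "V.subspace P" "V.subspace Q" using pts V.subspace_point by blast+
  obtain u where u: "u \<in> V.GL" "\<And>x. x \<in> P + Q \<Longrightarrow> u x = x" "u ` S = X"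
    using V.GL_fixing_subspace_transitive[OF V.subspace_plus[OF sub] pts(3) X(1)] assms by blast
  have fixed: "u ` P = P" "u ` Q = Q"
    using V.subset_plus[OF sub] u(2) by (force simp: subset_iff)+
  have "restrict (\<lambda>P. u ` P) V.points \<in> V.PGL" using u(1) by (auto simp: V.PGL_def)
  then obtain h' where "h' \<in> V'.PGL"
    and h': "\<And>A. A \<in> V.points \<Longrightarrow> f (restrict (\<lambda>P. u ` P) V.points A) = h' (f A)"
    using map unfolding PGL_mapping_def by blast
  then obtain u' where u': "u' \<in> V'.GL" "h' = restrict (\<lambda>P. u' ` P) V'.points"
    by (auto simp: V'.PGL_def)
  have eqs: "u' ` f P = f P" "u' ` f Q = f Q" "u' ` f S = f X"
    using h'[OF pts(1)] h'[OF pts(2)] h'[OF pts(3)] pts f_pts fixed u(3) u'(2) by simp_all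
  have "f P \<noteq> f Q"
    using bij pts \<open>P \<noteq> Q\<close> by (auto simp: bij_betw_def inj_on_eq_iff)
  then have "W = f P + f Q"
    using V'.plane_eq_plus_points W f_pts by blast
  then have "u' ` W = W" using V'.GL_image_plus[OF u'(1)] eqs by simp
  then show ?thesis using eqs(3) W(4) by blast
qed

text \<open>
  The preceding lemma is applied to the pairs \<open>P\<close>, \<open>Q\<close> and \<open>P\<close>, \<open>S\<close>, so that \<open>W\<close> receives the image
  of every point.
\<close>

theorem theorem1:
  fixes s :: "'r::division_ring \<Rightarrow> 'v::ab_group_add \<Rightarrow> 'v"
    and s' :: "'r2::division_ring \<Rightarrow> 'v2::ab_group_add \<Rightarrow> 'v2"
    and f :: "'v set \<Rightarrow> 'v2 set"
  assumes "left_vector_space s"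
    and "left_vector_space s'"
    and "left_vector_space.dim_at_least s 3"
    and "left_vector_space.dim_at_least s' 3"
    and "PGL_bijection s s' f"
  shows "semicollineation s' s (inv_into (left_vector_space.points s) f)"
proof -
  interpret V: left_vector_space s by fact
  interpret V': left_vector_space s' by fact
  let ?g = "inv_into V.points f"
  have bij: "bij_betw f V.points V'.points"
    using assms(5) by (simp add: PGL_bijection_def)
  have g_bij: "bij_betw ?g V'.points V.points"
    using bij_betw_inv_into[OF bij] .
  have "V.collinear (?g P') (?g Q') (?g S')"
    if pts': "P' \<in> V'.points" "Q' \<in> V'.points" "S' \<in> V'.points"
      and dist': "P' \<noteq> Q'" "Q' \<noteq> S'" "P' \<noteq> S'" and col: "V'.collinear P' Q' S'" for P' Q' S'
  proof (rule ccontr)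
    define P Q S where PQS: "P = ?g P'" "Q = ?g Q'" "S = ?g S'"
    assume "\<not> V.collinear (?g P') (?g Q') (?g S')"
    then have ncol: "\<not> V.collinear P Q S" by (simp add: PQS)
    have pts: "P \<in> V.points" "Q \<in> V.points" "S \<in> V.points"
      using pts' g_bij by (auto simp: PQS bij_betw_def)
    have f_eq: "f P = P'" "f Q = Q'" "f S = S'"
      using bij_betw_inv_into_right[OF bij] pts' by (simp_all add: PQS)
    have dist: "P \<noteq> Q" "P \<noteq> S" using f_eq dist' by auto
    define W where "W = P' + Q'"
    have W: "V'.subspace_of_dim 2 W"
      unfolding W_def using V'.plane_iff pts' dist'(1) by blast
    have subW: "P' \<subseteq> W" "Q' \<subseteq> W" "S' \<subseteq> W"
      using V'.subset_plus[OF V'.subspace_point V'.subspace_point] pts'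
        V'.collinear_iff[OF pts' dist'(1)] col by (auto simp: W_def)
    have offS: "\<not> S \<subseteq> P + Q" using V.collinear_iff pts dist ncol by blast
    have offQ: "\<not> Q \<subseteq> P + S"
      using V.collinear_iff[OF pts(1,3,2) dist(2)] ncol by (auto simp: V.collinear_def)
    have all: "f X \<subseteq> W" if X: "X \<in> V.points" for X
    proof (cases "X = P")
      case True
      then show ?thesis using f_eq subW by simp
    next
      case False
      \<comment> \<open>Otherwise \<open>X\<close> and \<open>P\<close> would span both \<open>P + Q\<close> and \<open>P + S\<close>.\<close>
      have "\<not> (X \<subseteq> P + Q \<and> X \<subseteq> P + S)"
      proof
        assume "X \<subseteq> P + Q \<and> X \<subseteq> P + S"
        moreover have "\<not> X \<subseteq> P" using V.point_subset_point X pts False by blast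
        ultimately have "Q \<subseteq> P + X" "P + X \<subseteq> P + S"
          using V.point_exchange[OF V.subspace_point[OF pts(1)] pts(2) X]
            V.plus_subset_subspace V.subspace_plus V.subset_plus V.subspace_point pts by metis+
        then show False using offQ by blast
      qed
      then show ?thesis
        using plane_absorbs_image[OF assms(1,2,5) pts dist(1) offS W _ _ _ X]
          plane_absorbs_image[OF assms(1,2,5) pts(1,3,2) dist(2) offQ W _ _ _ X] f_eq subW
        by blast
    qed
    have "W \<noteq> UNIV" using V'.plane_neq_UNIV assms(4) W by blast
    then obtain x where x: "x \<notin> W" by blast
    have "V'.subspace W"
      unfolding W_def using V'.subspace_plus V'.subspace_point pts' by blast
    then have "x \<noteq> 0" using x V'.subspace_0 by blast
    then have "V'.ray x \<in> V'.points" using V'.point_iff by blast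
    then obtain X where "X \<in> V.points" "f X = V'.ray x"
      using bij unfolding bij_betw_def by (metis imageE)
    then show False using all x V'.self_in_ray by blast
  qed
  then show ?thesis using g_bij by (simp add: semicollineation_def)
qed

end
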